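(* Let $n\geq 4$ be an integer. Then $\Delta^o(S_n)^*$ is connected if and only if neither $n$ nor $n-1$ is a prime. Also, if $\Delta^o(S_n)^*$ is disconnected, then it has exactly two (connected) components.
   Context: $S_n$ is the symmetric group of degree $n$. For a finite group $G$, $o(g)$ denotes the order of $g\in G$, and the order super commuting graph $\Delta^o(G)$ is the simple undirected graph with vertex set $G$ in which two distinct elements $g,h$ are adjacent iff either $o(g)=o(h)$, or there exist $g',h'\in G$ with $o(g')=o(g)$, $o(h')=o(h)$ such that $g'$ and $h'$ are distinct and commute. A vertex is dominant if it is adjacent to every other vertex. The reduced order super commuting graph $\Delta^o(G)^*$ is the induced subgraph of $\Delta^o(G)$ obtained by deleting all dominant vertices of $\Delta^o(G)$. *)

theory Defs
  imports
    "HOL-Algebra.Sym_Groups"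
    "HOL-Algebra.Multiplicative_Group"
    "HOL-Computational_Algebra.Primes"
    "Graph_Theory.Digraph_Component"
begin

text \<open>
  As in Graph_Theory, a simple undirected graph is a loop-free symmetric digraph without
  parallel arcs: an edge between \<open>g\<close> and \<open>h\<close> is the pair of arcs \<open>(g, h)\<close>, \<open>(h, g)\<close>.
\<close>

definition order_super_commuting_graph ::
    "('a, 'm) monoid_scheme \<Rightarrow> ('a, 'a \<times> 'a) pre_digraph" where
  "order_super_commuting_graph G = with_proj
     \<lparr> pverts = carrier G,
       parcs = {(g, h). g \<in> carrier G \<and> h \<in> carrier G \<and> g \<noteq> h \<and>
         (group.ord G g = group.ord G h \<or>
          (\<exists>g' \<in> carrier G. \<exists>h' \<in> carrier G.
             group.ord G g' = group.ord G g \<and> group.ord G h' = group.ord G h \<and>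
             g' \<noteq> h' \<and> g' \<otimes>\<^bsub>G\<^esub> h' = h' \<otimes>\<^bsub>G\<^esub> g'))} \<rparr>"

definition dominant_vertices :: "('a, 'b) pre_digraph \<Rightarrow> 'a set" where
  "dominant_vertices D = {v \<in> verts D. \<forall>w \<in> verts D. w \<noteq> v \<longrightarrow> v \<rightarrow>\<^bsub>D\<^esub> w}"

definition reduced_order_super_commuting_graph ::
    "('a, 'm) monoid_scheme \<Rightarrow> ('a, 'a \<times> 'a) pre_digraph" where
  "reduced_order_super_commuting_graph G =
     (let D = order_super_commuting_graph G in D \<restriction> (verts D - dominant_vertices D))"

text \<open>
  Components are the maximal connected subgraphs. The predicate \<open>connected\<close> of Graph_Theory
  does not hold of the null graph, so a component has at least one vertex.
\<close>

definition connected_components :: "('a, 'b) pre_digraph \<Rightarrow> ('a, 'b) pre_digraph set" where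
  "connected_components D = {H. pre_digraph.max_subgraph D Digraph_Component.connected H}"

lemma graph_order_super_commuting_graph:
  assumes "finite (carrier G)"
  shows "graph (order_super_commuting_graph G)"
proof -
  let ?D = "order_super_commuting_graph G"
  have "arcs ?D \<subseteq> carrier G \<times> carrier G"
    by (auto simp: order_super_commuting_graph_def)
  then have "finite (arcs ?D)"
    using assms by (meson finite_SigmaI finite_subset)
  moreover have "sym (arcs_ends ?D)"
    unfolding order_super_commuting_graph_def
    by (rule symI) (auto simp: arcs_ends_conv; metis)
  ultimately show ?thesis
    using assms
    by unfold_locales
      (auto simp: order_super_commuting_graph_def symmetric_def arc_to_ends_def)
qed

end

theory Submission
  imports Defs
begin

text \<open>
  Adjacency depends on orders only. Let \<open>s k\<close> (below \<open>ppsum\<close>) be the sum of the prime powers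
  exactly dividing \<open>k\<close>; \<open>S\<^sub>n\<close> has an element of order \<open>k\<close> iff \<open>s k \<le> n\<close>. Commuting elements of coprime
  orders \<open>a\<close> and \<open>b\<close> have a product of order \<open>a b\<close>, so \<open>a\<close> and \<open>b\<close> are adjacent only if
  \<open>s a + s b \<le> n\<close>; conversely two orders dividing some \<open>k\<close> with \<open>s k \<le> n\<close> are adjacent.

  If \<open>p \<in> {n - 1, n}\<close> is prime, then the order \<open>p\<close> is adjacent only to \<open>1\<close> and itself, hence only the
  identity is dominant. Every other order \<open>m > 1\<close> has a prime divisor \<open>q \<le> n - 2\<close>, and
  \<open>m, q, 2\<close> is a path; so there are two components.

  If neither is prime, the same path works provided that the primes \<open>q\<close> and \<open>2\<close> are not
  dominant. This needs orders \<open>m\<close> prime to \<open>q\<close> with \<open>n - q < s m \<le> n\<close>. They come from writing \<open>n\<close> or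
  \<open>n - 1\<close> as a sum of distinct odd primes, which is possible by Richert's inductive argument once
  the odd primes up to \<open>x\<close> have sum \<open>\<sigma> \<ge> x + 5\<close>. If there are \<open>r\<close> primes up to \<open>x\<close>, then
  \<open>2 ^ (x - 1) \<le> lcm (1, \<dots>, x) \<le> x ^ r\<close>, while \<open>r\<^sup>2 \<le> \<sigma> + 1\<close> since distinct odd numbers are
  summed; this gives the bound for large \<open>x\<close>.
\<close>

section \<open>Sums of prime power parts\<close>

text \<open>For \<open>n > 0\<close> this is the least number of points carrying a permutation of
  order \<open>n\<close>. Since 0 has no prime factors here, \<open>ppsum 0 = 0\<close>, hence the
  positivity assumptions below.\<close>

definition ppsum :: "nat \<Rightarrow> nat" where
  "ppsum n = (\<Sum>p\<in>prime_factors n. p ^ multiplicity p n)"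

lemma ppsum_1 [simp]: "ppsum (Suc 0) = 0"
  by (simp add: ppsum_def)

lemma ppsum_prime_power:
  assumes "Factorial_Ring.prime p" "k > 0"
  shows "ppsum (p ^ k) = p ^ k"
proof -
  have "prime_factors (p ^ k) = {p}"
    using assms by (simp add: prime_factorization_prime_power)
  then show ?thesis
    using assms by (simp add: ppsum_def)
qed

lemma ppsum_prime: "Factorial_Ring.prime p \<Longrightarrow> ppsum p = p"
  using ppsum_prime_power[of p 1] by simp

lemma ppsum_mult_coprime:
  assumes "coprime a b" "a > 0" "b > 0"
  shows "ppsum (a * b) = ppsum a + ppsum b"
proof -
  have disj: "prime_factors a \<inter> prime_factors b = {}"
  proof (intro equals0I)
    fix p assume "p \<in> prime_factors a \<inter> prime_factors b"
    then have "Factorial_Ring.prime p" "p dvd a" "p dvd b"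
      using assms by (auto simp: prime_factors_dvd)
    then show False using coprime_common_divisor[OF assms(1)] not_prime_unit by blast
  qed
  have "prime_factors (a * b) = prime_factors a \<union> prime_factors b"
    using assms by (simp add: prime_factors_product)
  then have "ppsum (a * b) = (\<Sum>p\<in>prime_factors a. p ^ multiplicity p (a * b)) +
      (\<Sum>p\<in>prime_factors b. p ^ multiplicity p (a * b))"
    using disj by (simp add: ppsum_def sum.union_disjoint)
  moreover have "multiplicity p (a * b) = multiplicity p a" if "p \<in> prime_factors a" for p
  proof -
    have "\<not> p dvd b" using that disj assms by (auto simp: prime_factors_dvd)
    then show ?thesis using that assms
      by (simp add: prime_factors_dvd prime_elem_multiplicity_mult_distrib not_dvd_imp_multiplicity_0)
  qed
  moreover have "multiplicity p (a * b) = multiplicity p b" if "p \<in> prime_factors b" for p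
  proof -
    have "\<not> p dvd a" using that disj assms by (auto simp: prime_factors_dvd)
    then show ?thesis using that assms
      by (simp add: prime_factors_dvd prime_elem_multiplicity_mult_distrib not_dvd_imp_multiplicity_0)
  qed
  ultimately show ?thesis
    by (simp add: ppsum_def)
qed

lemma sum_le_prod_nat:
  fixes f :: "'a \<Rightarrow> nat"
  assumes "finite A" "\<And>x. x \<in> A \<Longrightarrow> f x \<ge> 2"
  shows "sum f A \<le> prod f A"
  using assms
proof (induction A)
  case (insert a A)
  have IH: "sum f A \<le> prod f A" and a: "f a \<ge> 2"
    using insert by auto
  show ?case
  proof (cases "A = {}")
    case False
    then have "sum f A \<ge> 2"
      using insert by (metis all_not_in_conv insertCI member_le_sum order_trans zero_le)
    then have "prod f A \<ge> 2" using IH by simp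
    \<comment> \<open>For numbers at least 2 the sum is at most the product; the shift by 2 makes
      this a comparison of polynomials with natural coefficients.\<close>
    then obtain c where c: "prod f A = c + 2" by (metis add.commute le_Suc_ex)
    obtain d where d: "f a = d + 2" using a by (metis add.commute le_Suc_ex)
    have "f a + prod f A \<le> f a * prod f A"
      unfolding c d by (simp add: algebra_simps)
    then show ?thesis using IH insert by simp
  qed (use insert in simp)
qed simp

text \<open>\<open>n\<close> is the product of its prime power parts, all at least 2. Applied to
  cycle lengths: a cycle of length \<open>d\<close> uses at least \<open>ppsum d\<close>
  points.\<close>

lemma ppsum_le:
  assumes "n > 0"
  shows "ppsum n \<le> n"
proof -
  have "p ^ multiplicity p n \<ge> 2" if "p \<in> prime_factors n" for p
  proof -
    have "p ^ multiplicity p n \<ge> p ^ 1"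
      using that by (intro power_increasing)
        (auto simp: prime_factors_multiplicity prime_ge_Suc_0_nat intro: Suc_leI)
    moreover have "p \<ge> 2" using that by (auto intro: prime_ge_2_nat)
    ultimately show ?thesis by simp
  qed
  then have "ppsum n \<le> (\<Prod>p\<in>prime_factors n. p ^ multiplicity p n)"
    unfolding ppsum_def by (intro sum_le_prod_nat) auto
  also have "\<dots> = n"
    using assms by (simp add: prod_prime_factors)
  finally show ?thesis .
qed

lemma ppsum_dvd_mono:
  assumes "a dvd b" "b > 0"
  shows "ppsum a \<le> ppsum b"
proof -
  have "ppsum a \<le> (\<Sum>p\<in>prime_factors a. p ^ multiplicity p b)"
    unfolding ppsum_def using assms
    by (intro sum_mono power_increasing) (auto intro: dvd_imp_multiplicity_le prime_ge_Suc_0_nat)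
  also have "\<dots> \<le> ppsum b"
    unfolding ppsum_def using assms by (intro sum_mono2 dvd_prime_factors) auto
  finally show ?thesis .
qed

text \<open>Each prime power exactly dividing the lcm already exactly divides \<open>a\<close> or
  \<open>b\<close>.\<close>

lemma ppsum_lcm_le:
  assumes "a > 0" "b > 0"
  shows "ppsum (lcm a b) \<le> ppsum a + ppsum b"
proof -
  let ?A = "prime_factors a" and ?B = "prime_factors b"
  let ?f = "\<lambda>c p. if p \<in> prime_factors c then p ^ multiplicity p c else (0::nat)"
  have "prime_factors (lcm a b) = ?A \<union> ?B"
    using assms
    by (metis prime_factorization_lcm set_mset_sup less_not_refl)
  then have "ppsum (lcm a b) = (\<Sum>p\<in>?A \<union> ?B. p ^ multiplicity p (lcm a b))"
    by (simp add: ppsum_def)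
  also have "\<dots> \<le> (\<Sum>p\<in>?A \<union> ?B. ?f a p + ?f b p)"
  proof (rule sum_mono)
    fix p assume p: "p \<in> ?A \<union> ?B"
    then have "Factorial_Ring.prime p" by auto
    then show "p ^ multiplicity p (lcm a b) \<le> ?f a p + ?f b p"
      using assms p by (auto simp: multiplicity_lcm max_def prime_factors_multiplicity)
  qed
  also have "\<dots> = (\<Sum>p\<in>?A \<union> ?B. ?f a p) + (\<Sum>p\<in>?A \<union> ?B. ?f b p)"
    by (rule sum.distrib)
  also have "(\<Sum>p\<in>?A \<union> ?B. ?f a p) = ppsum a"
    unfolding ppsum_def by (intro sum.mono_neutral_cong_right) auto
  also have "(\<Sum>p\<in>?A \<union> ?B. ?f b p) = ppsum b"
    unfolding ppsum_def by (intro sum.mono_neutral_cong_right) auto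
  finally show ?thesis .
qed

lemma ppsum_ge_2:
  assumes "n > 1"
  shows "ppsum n \<ge> 2"
proof -
  obtain p where p: "Factorial_Ring.prime p" "p dvd n"
    using assms prime_factor_nat[of n] by auto
  then show ?thesis
    using ppsum_dvd_mono[of p n] assms ppsum_prime[of p] prime_ge_2_nat[of p] by simp
qed

text \<open>A further factor \<open>p\<close> gives the part \<open>p ^ 2\<close> or a higher power,
  any other factor adds a part of at least 2. So proper multiples of a prime \<open>p\<close> close
  to \<open>n\<close> are not orders in the symmetric group.\<close>

lemma ppsum_prime_mult_ge:
  assumes p: "Factorial_Ring.prime p" and "p > 2" "r > 1"
  shows "ppsum (p * r) \<ge> p + 2"
proof (cases "p dvd r")
  case True
  have "p + 2 \<le> p * p"
    using \<open>p > 2\<close> mult_le_mono1[of 3 p p] by linarith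
  also have "\<dots> = ppsum (p ^ 2)"
    using ppsum_prime_power[OF p, of 2] by (simp add: power2_eq_square)
  also have "\<dots> \<le> ppsum (p * r)"
    using True assms by (intro ppsum_dvd_mono) (auto simp: power2_eq_square)
  finally show ?thesis .
next
  case False
  then have "ppsum (p * r) = p + ppsum r"
    using assms by (simp add: ppsum_mult_coprime prime_imp_coprime ppsum_prime)
  then show ?thesis using ppsum_ge_2[of r] assms by simp
qed

lemma ppsum_prod_primes:
  assumes "finite P" "\<And>p. p \<in> P \<Longrightarrow> Factorial_Ring.prime p"
  shows "ppsum (\<Prod>P) = \<Sum>P"
  using assms
proof (induction P)
  case (insert p P)
  have "coprime p (\<Prod>P)"
    using insert by (intro prod_coprime_right) (metis insertCI primes_coprime)
  moreover have "\<Prod>P > 0"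
    using insert by (intro prod_pos) (auto simp: prime_gt_0_nat)
  ultimately show ?case
    using insert by (simp add: ppsum_mult_coprime ppsum_prime prime_gt_0_nat)
qed simp

section \<open>Sums of distinct odd primes\<close>

text \<open>
  Induction on \<open>k\<close> along the recurrence of Leibniz' harmonic triangle,
  \<open>1 / ((k + 1) (n choose (k + 1))) = 1 / (k ((n - 1) choose k)) - 1 / (k (n choose k))\<close>.
\<close>

lemma leibniz_triangle_dvd_Lcm:
  assumes "1 \<le> k" "k \<le> n"
  shows "k * (n choose k) dvd Lcm {1..n}"
  using assms
proof (induction k arbitrary: n rule: nat_induct_at_least)
  case base
  then show ?case by (auto intro: dvd_Lcm)
next
  case (Suc k)
  obtain m where n: "n = Suc m" using Suc.prems by (cases n) auto
  have km: "k \<le> m" using Suc.prems n by simp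
  let ?L = "Lcm {1..n}"
  let ?a = "k * (m choose k)" and ?b = "k * (n choose k)" and ?c = "Suc k * (n choose Suc k)"
  have a: "?a dvd ?L"
    using Suc.IH[OF km] by (rule dvd_trans) (auto intro!: Lcm_least dvd_Lcm simp: n)
  have b: "?b dvd ?L" using Suc.IH[of n] km n by simp
  obtain u where u: "?L = ?a * u" using a by (elim dvdE)
  obtain v where v: "?L = ?b * v" using b by (elim dvdE)
  have pos: "m choose k > 0" "n choose k > 0" "k > 0" using km n Suc.hyps by auto
  have c: "?c = n * (m choose k)" using Suc_times_binomial_eq[of m k] by (simp add: n mult.commute)
  have nk: "(n - k) * (n choose k) = n * (m choose k)"
    using binomial_absorb_comp[of n k] n by simp
  \<comment> \<open>The recurrence multiplied by \<open>?L\<close> reads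
    \<open>?L / ?c = u - v\<close>, so the quotient is an integer. The subtraction calls for
    \<open>int\<close>.\<close>
  have "int (n * (m choose k)) * (int u - int v) = int ?L"
  proof -
    have "int k * (int (n * (m choose k)) * (int u - int v)) =
        int n * int ?L - int k * int ((n - k) * (n choose k)) * int v"
      unfolding nk by (subst u) (simp add: algebra_simps)
    also have "int k * int ((n - k) * (n choose k)) * int v = int (n - k) * int ?L"
      by (subst v) (simp only: of_nat_mult mult_ac)
    also have "int n * int ?L - int (n - k) * int ?L = int k * int ?L"
    proof -
      have "int n = int k + int (n - k)" using km n by simp
      then have "int n * int ?L = (int k + int (n - k)) * int ?L" by (rule arg_cong)
      then show ?thesis by (simp add: distrib_right)
    qed
    finally show ?thesis using pos by simp
  qed
  then have "int ?c dvd int ?L" unfolding c by (metis dvd_triv_left)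
  then show ?case by presburger
qed

text \<open>The \<open>n\<close> numbers \<open>k * (n choose k)\<close> all divide the lcm and add
  up to \<open>n * 2 ^ (n - 1)\<close>.\<close>

lemma two_power_le_Lcm:
  assumes "n \<ge> 1"
  shows "2 ^ (n - 1) \<le> Lcm {1..n}"
proof -
  have "n * 2 ^ (n - 1) = (\<Sum>k\<le>n. k * (n choose k))"
    by (simp add: choose_linear_sum)
  also have "\<dots> = (\<Sum>k\<in>{1..n}. k * (n choose k))"
    by (intro sum.mono_neutral_right) auto
  also have "\<dots> \<le> (\<Sum>k\<in>{1..n}. Lcm {1..n})"
    using Lcm_0_iff_nat[of "{1..n}"]
    by (intro sum_mono dvd_imp_le[OF leibniz_triangle_dvd_Lcm]) (auto simp del: Lcm_0_iff_nat)
  also have "\<dots> = n * Lcm {1..n}" by simp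
  finally show ?thesis using assms by simp
qed

text \<open>Each prime power exactly dividing the lcm divides some \<open>i \<le> n\<close>, so each
  of the prime parts is at most \<open>n\<close>.\<close>

lemma Lcm_upto_le_power:
  fixes n :: nat
  assumes "n \<ge> 1"
  shows "Lcm {1..n} \<le> n ^ card {p. Factorial_Ring.prime p \<and> p \<le> n}"
proof -
  let ?L = "Lcm {1..n}"
  have L0: "?L \<noteq> 0" using Lcm_0_iff_nat[of "{1..n}"] by auto
  have ub: "p ^ multiplicity p ?L \<le> n" if p: "p \<in> prime_factors ?L" for p
  proof -
    have "Factorial_Ring.prime p" using p by auto
    have "multiplicity p ?L > 0" using p by (simp add: prime_factors_multiplicity)
    define k where "k = multiplicity p ?L - 1"
    have mult: "multiplicity p ?L = Suc k" using \<open>multiplicity p ?L > 0\<close> by (simp add: k_def)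
    have "\<exists>i\<in>{1..n}. p ^ Suc k dvd i"
    proof (rule ccontr)
      assume *: "\<not> ?thesis"
      \<comment> \<open>If no \<open>i\<close> were divisible by the full power of \<open>p\<close>,
        the lcm divided by \<open>p\<close> would still be a common multiple.\<close>
      define M where "M = ?L div p"
      have M: "?L = p * M" using p by (simp add: M_def prime_factors_dvd)
      have "i dvd M" if i: "i \<in> {1..n}" for i
      proof -
        have "i dvd ?L" using i by (rule dvd_Lcm)
        show ?thesis
        proof (rule multiplicity_le_imp_dvd)
          show "i \<noteq> 0" using i by simp
          fix q :: nat assume q: "Factorial_Ring.prime q"
          have M0: "M \<noteq> 0" using M L0 by auto
          show "multiplicity q i \<le> multiplicity q M"
          proof (cases "q = p")
            case True
            have "multiplicity p i < Suc k"
              using * i q True by (metis atLeastAtMost_iff multiplicity_dvd' not_less not_one_le_zero)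
            moreover have "multiplicity p ?L = Suc (multiplicity p M)"
              unfolding M using M0 q True
              by (simp add: prime_elem_multiplicity_mult_distrib)
            ultimately show ?thesis using mult True by simp
          next
            case False
            have "multiplicity q i \<le> multiplicity q ?L"
              using \<open>i dvd ?L\<close> L0 by (rule dvd_imp_multiplicity_le)
            also have "\<dots> = multiplicity q M"
              unfolding M using M0 q False \<open>Factorial_Ring.prime p\<close>
              by (simp add: prime_elem_multiplicity_mult_distrib prime_gt_0_nat
                    prime_multiplicity_other)
            finally show ?thesis .
          qed
        qed
      qed
      then have "?L dvd M" by (rule Lcm_least)
      then have "p * M \<le> M" using M L0 by (intro dvd_imp_le) auto
      moreover have "M > 0" using M L0 by (cases M) auto
      moreover have "p > 1" using \<open>Factorial_Ring.prime p\<close> by (rule prime_gt_1_nat)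
      ultimately show False by simp
    qed
    then show ?thesis using mult by (auto dest!: dvd_imp_le)
  qed
  have "?L = (\<Prod>p\<in>prime_factors ?L. p ^ multiplicity p ?L)"
    using L0 by (simp add: prod_prime_factors)
  also have "\<dots> \<le> (\<Prod>p\<in>prime_factors ?L. n)"
    using ub by (intro prod_mono) auto
  also have "\<dots> = n ^ card (prime_factors ?L)" by simp
  also have "\<dots> \<le> n ^ card {p. Factorial_Ring.prime p \<and> p \<le> n}"
  proof (rule power_increasing[OF card_mono])
    show "prime_factors ?L \<subseteq> {p. Factorial_Ring.prime p \<and> p \<le> n}"
    proof safe
      fix p assume p: "p \<in> prime_factors ?L"
      then have "p ^ 1 \<le> p ^ multiplicity p ?L"
        by (intro power_increasing) (auto simp: prime_factors_multiplicity prime_ge_Suc_0_nat intro: Suc_leI)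
      then show "p \<le> n" using ub[OF p] by simp
    qed auto
  qed (use assms in auto)
  finally show ?thesis .
qed


section \<open>A lower bound for the sum of the odd primes up to x\<close>

lemma sum_odd_ge_card_squared:
  fixes A :: "nat set"
  assumes "finite A" "\<And>a. a \<in> A \<Longrightarrow> odd a"
  shows "(card A)\<^sup>2 \<le> \<Sum>A"
  using assms
proof (induction A rule: finite_linorder_max_induct)
  case (insert b A)
  \<comment> \<open>Only \<open>b div 2\<close> odd numbers lie below the new maximum
    \<open>b\<close>, so \<open>b\<close> is at least the increment \<open>2 * card A + 1\<close> of
    the square.\<close>
  have "A \<subseteq> (\<lambda>i. 2 * i + 1) ` {..<b div 2}"
  proof
    fix a assume "a \<in> A"
    then have "odd a" "a < b" "odd b" using insert by auto
    then show "a \<in> (\<lambda>i. 2 * i + 1) ` {..<b div 2}"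
      by (intro image_eqI[of _ _ "a div 2"]) (auto elim!: oddE)
  qed
  then have "card A \<le> card ((\<lambda>i. 2 * i + 1) ` {..<b div 2})"
    by (intro card_mono) auto
  also have "\<dots> \<le> b div 2"
    using card_image_le[of "{..<b div 2}" "\<lambda>i. 2 * i + 1"] by simp
  finally have "card A \<le> b div 2" .
  moreover have "odd b" using insert.prems by simp
  ultimately have "2 * card A + 1 \<le> b" by presburger
  moreover have "b \<notin> A" using insert by auto
  moreover have "(card A)\<^sup>2 \<le> \<Sum>A" using insert by auto
  ultimately show ?case using insert by (simp add: power2_eq_square)
qed simp

definition odd_primes_upto :: "nat \<Rightarrow> nat set" where
  "odd_primes_upto x = {p. Factorial_Ring.prime p \<and> odd p \<and> p \<le> x}"

lemma finite_odd_primes_upto [simp]: "finite (odd_primes_upto x)"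
  by (rule finite_subset[of _ "{..x}"]) (auto simp: odd_primes_upto_def)

lemma card_primes_upto_squared_le:
  assumes "x \<ge> 2"
  shows "(card {p. Factorial_Ring.prime p \<and> p \<le> x})\<^sup>2 \<le> \<Sum>(odd_primes_upto x) + 1"
proof -
  have eq: "{p. Factorial_Ring.prime p \<and> p \<le> x} = insert 2 (odd_primes_upto x)"
    using assms prime_odd_nat by (auto simp: odd_primes_upto_def) (metis le_neq_implies_less prime_ge_2_nat)
  have "2 \<notin> odd_primes_upto x" "1 \<notin> odd_primes_upto x"
    by (auto simp: odd_primes_upto_def)
  \<comment> \<open>Exchanging the prime 2 for 1 keeps the cardinality and leaves odd numbers only;
    this costs the \<open>+ 1\<close>.\<close>
  then have "card {p. Factorial_Ring.prime p \<and> p \<le> x} = card (insert 1 (odd_primes_upto x))"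
    unfolding eq by simp
  also have "(card (insert 1 (odd_primes_upto x)))\<^sup>2 \<le> \<Sum>(insert 1 (odd_primes_upto x))"
    by (rule sum_odd_ge_card_squared) (auto simp: odd_primes_upto_def)
  also have "\<dots> = \<Sum>(odd_primes_upto x) + 1"
    using \<open>1 \<notin> _\<close> by simp
  finally show ?thesis .
qed

lemma sum_odd_primes_upto_ge:
  assumes "x \<ge> 10"
  shows "\<Sum>(odd_primes_upto x) \<ge> x + 5"
proof -
  have small: "\<Sum>(odd_primes_upto x) \<ge> \<Sum>P" if "P \<subseteq> odd_primes_upto x" for P
    using that by (intro sum_mono2) auto
  have primes: "Factorial_Ring.prime (3::nat)" "Factorial_Ring.prime (5::nat)" "Factorial_Ring.prime (7::nat)"
    "Factorial_Ring.prime (11::nat)" "Factorial_Ring.prime (13::nat)" "Factorial_Ring.prime (17::nat)"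
    "Factorial_Ring.prime (19::nat)" by simp_all
  \<comment> \<open>The prime sets used below have sums 15, 26 and 75, each at least 5 more than the
    end of its range. From 64 on the lcm estimate applies.\<close>
  consider "x = 10" | "x \<in> {11..18}" | "x \<in> {19..63}" | "x \<ge> 64"
    using assms by force
  then show ?thesis
  proof cases
    case 1
    then show ?thesis using small[of "{3, 5, 7}"] primes by (auto simp: odd_primes_upto_def)
  next
    case 2
    then show ?thesis using small[of "{3, 5, 7, 11}"] primes by (auto simp: odd_primes_upto_def)
  next
    case 3
    then show ?thesis using small[of "{3, 5, 7, 11, 13, 17, 19}"] primes
      by (auto simp: odd_primes_upto_def)
  next
    case 4
    show ?thesis
    proof (rule ccontr)
      assume *: "\<not> ?thesis"
      define r where "r = card {p. Factorial_Ring.prime p \<and> p \<le> x}"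
      have r: "r\<^sup>2 \<le> x + 5"
        using card_primes_upto_squared_le[of x] * 4 by (simp add: r_def)
      \<comment> \<open>\<open>k\<close> is the integer part of the binary logarithm of
        \<open>x\<close>; it turns the lcm estimate into a comparison of exponents.\<close>
      obtain k where k: "2 ^ k \<le> x" "x < 2 ^ (k + 1)"
        using ex_power_ivl1[of 2 x] 4 by auto
      have "k \<ge> 6"
      proof (rule ccontr)
        assume "\<not> k \<ge> 6"
        then have "(2::nat) ^ (k + 1) \<le> 2 ^ 6" by (intro power_increasing) auto
        then show False using k 4 by simp
      qed
      have "2 ^ (x - 1) \<le> x ^ r"
        using two_power_le_Lcm[of x] Lcm_upto_le_power[of x] 4 by (simp add: r_def)
      also have "x ^ r \<le> (2 ^ (k + 1)) ^ r"
        using k by (intro power_mono) auto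
      also have "\<dots> = 2 ^ ((k + 1) * r)" by (rule power_mult [symmetric])
      finally have "x - 1 \<le> (k + 1) * r" by simp
      then have "(x - 1)\<^sup>2 \<le> ((k + 1) * r)\<^sup>2" by (rule power_mono) simp
      also have "\<dots> \<le> (k + 1)\<^sup>2 * (x + 5)"
        unfolding power_mult_distrib using r by (rule mult_le_mono2)
      finally have 1: "(x - 1)\<^sup>2 \<le> (k + 1)\<^sup>2 * (x + 5)" .
      \<comment> \<open>Since \<open>(x - 1)^2 = (x - 7) * (x + 5) + 36\<close>, the factor
        \<open>x + 5\<close> cancels and \<open>x - 7 < (k + 1)^2\<close> remains, which fails for
        \<open>k \<ge> 6\<close>.\<close>
      obtain y where y: "x = y + 7" using 4 by (intro that[of "x - 7"]) simp
      have "(x - 1)\<^sup>2 = y * (x + 5) + 36" unfolding y by (simp add: power2_eq_square algebra_simps)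
      then have "y * (x + 5) < (k + 1)\<^sup>2 * (x + 5)" using 1 by linarith
      then have "y < (k + 1)\<^sup>2" by simp
      moreover have "(k + 1)\<^sup>2 + 7 \<le> 2 ^ k"
        using \<open>k \<ge> 6\<close>
      proof (induction k rule: nat_induct_at_least)
        case (Suc k)
        have "6 * k \<le> k * k" using Suc.hyps by simp
        then show ?case using Suc by (simp add: power2_eq_square)
      qed (simp add: power2_eq_square)
      ultimately show False using k y by linarith
    qed
  qed
qed

text \<open>
  Richert's induction: passing from \<open>x\<close> to a prime \<open>q = x + 1\<close>, the numbers that became
  available with \<open>q\<close> overlap those available before as soon as \<open>q + 4\<close> is at most the sum of the
  smaller odd primes.
\<close>

lemma ex_odd_primes_sum_below:
  assumes "x \<ge> 7" "3 \<le> n" "n + 2 \<le> \<Sum>(odd_primes_upto x)"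
  shows "\<exists>P\<subseteq>odd_primes_upto x. \<Sum>P = n \<or> \<Sum>P + 1 = n"
  using assms
proof (induction x arbitrary: n rule: nat_induct_at_least)
  case base
  have eq: "odd_primes_upto 7 = {3, 5, 7}"
  proof -
    have "p \<in> {3, 5, 7}" if "odd p" "p \<le> 7" "p > 1" for p :: nat
    proof -
      have "p \<in> {1,2,3,4,5,6,7}" using that by force
      then show ?thesis using that by auto
    qed
    then have "odd_primes_upto 7 \<subseteq> {3, 5, 7}"
      by (auto simp: odd_primes_upto_def simp del: One_nat_def dest: prime_gt_1_nat)
    moreover have "Factorial_Ring.prime (3::nat)" "Factorial_Ring.prime (5::nat)"
      "Factorial_Ring.prime (7::nat)" by simp_all
    ultimately show ?thesis by (auto simp: odd_primes_upto_def)
  qed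
  have "n \<le> 13" using base.prems by (simp add: eq)
  \<comment> \<open>Each subset of \<open>{3, 5, 7}\<close> chosen below serves its sum and, except
    for \<open>{7}\<close>, also the successor of its sum.\<close>
  then consider "n \<in> {3..4}" | "n \<in> {5..6}" | "n = 7" | "n \<in> {8..9}" | "n \<in> {10..11}" | "n \<in> {12..13}"
    using base.prems(1) unfolding atLeastAtMost_iff by linarith
  then show ?case
  proof cases
    case 1 then show ?thesis unfolding eq by (intro exI[of _ "{3}"]) auto
  next
    case 2 then show ?thesis unfolding eq by (intro exI[of _ "{5}"]) auto
  next
    case 3 then show ?thesis unfolding eq by (intro exI[of _ "{7}"]) auto
  next
    case 4 then show ?thesis unfolding eq by (intro exI[of _ "{3, 5}"]) auto
  next
    case 5 then show ?thesis unfolding eq by (intro exI[of _ "{3, 7}"]) auto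
  next
    case 6 then show ?thesis unfolding eq by (intro exI[of _ "{5, 7}"]) auto
  qed
next
  case (Suc x)
  let ?q = "Suc x" and ?S = "\<Sum>(odd_primes_upto x)"
  have sub: "odd_primes_upto x \<subseteq> odd_primes_upto ?q"
    by (auto simp: odd_primes_upto_def)
  show ?case
  proof (cases "n + 2 \<le> ?S")
    case True
    then show ?thesis using Suc.IH[of n] Suc.prems sub by blast
  next
    case False
    \<comment> \<open>The bound on \<open>n\<close> holds at \<open>Suc x\<close> but not at
      \<open>x\<close>, so the set of odd primes has grown.\<close>
    have q: "Factorial_Ring.prime ?q" "odd ?q"
    proof -
      have "odd_primes_upto ?q \<noteq> odd_primes_upto x"
        using False Suc.prems by auto
      then show "Factorial_Ring.prime ?q" "odd ?q"
        by (auto simp: odd_primes_upto_def le_Suc_eq)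
    qed
    have eq: "odd_primes_upto ?q = insert ?q (odd_primes_upto x)"
      using q by (auto simp: odd_primes_upto_def le_Suc_eq)
    have nin: "?q \<notin> odd_primes_upto x" by (simp add: odd_primes_upto_def)
    have "x \<noteq> 7" "x \<noteq> 8" "x \<noteq> 9" using q by (auto intro!: notI)
    then have "x \<ge> 10" using Suc.hyps by simp
    then have S: "?S \<ge> x + 5" by (rule sum_odd_primes_upto_ge)
    \<comment> \<open>From \<open>n + 2 > ?S \<ge> ?q + 4\<close> follows
      \<open>n - ?q \<ge> 3\<close>, so the induction hypothesis applies to \<open>n - ?q\<close>.
      Its subset cannot contain \<open>?q\<close>.\<close>
    have "n - ?q + 2 \<le> ?S" "3 \<le> n - ?q" "?q \<le> n"
      using Suc.prems False S nin unfolding eq by auto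
    then obtain P where P: "P \<subseteq> odd_primes_upto x" "\<Sum>P = n - ?q \<or> \<Sum>P + 1 = n - ?q"
      using Suc.IH[of "n - ?q"] by blast
    have "finite P" "?q \<notin> P"
      using P(1) nin finite_subset[OF P(1) finite_odd_primes_upto] by auto
    then have "\<Sum>(insert ?q P) = ?q + \<Sum>P" by simp
    then have "\<Sum>(insert ?q P) = n \<or> \<Sum>(insert ?q P) + 1 = n"
      using P(2) \<open>?q \<le> n\<close> by auto
    moreover have "insert ?q P \<subseteq> odd_primes_upto ?q" using P(1) eq by auto
    ultimately show ?thesis by blast
  qed
qed

text \<open>The primes up to \<open>n + 10\<close> suffice. The alternative
  \<open>\<Sum>P + 1 = n\<close> cannot be dropped: 4, for instance, is not a sum of distinct odd
  primes.\<close>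

lemma ex_odd_primes_sum:
  fixes n :: nat
  assumes "n \<ge> 3"
  shows "\<exists>P. finite P \<and> (\<forall>p\<in>P. Factorial_Ring.prime p \<and> odd p) \<and> (\<Sum>P = n \<or> \<Sum>P + 1 = n)"
proof -
  have "n + 10 + 5 \<le> \<Sum>(odd_primes_upto (n + 10))"
    by (rule sum_odd_primes_upto_ge) simp
  then obtain P where "P \<subseteq> odd_primes_upto (n + 10)" "\<Sum>P = n \<or> \<Sum>P + 1 = n"
    using ex_odd_primes_sum_below[of "n + 10" n] assms by auto
  then show ?thesis
    using finite_subset[OF _ finite_odd_primes_upto]
    by (intro exI[of _ P]) (auto simp: odd_primes_upto_def)
qed

section \<open>Orders of permutations\<close>

lemma funpow_dvd_fixpoint:
  assumes "(f ^^ d) x = x" "d dvd e"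
  shows "(f ^^ e) x = x"
proof -
  obtain m where e: "e = d * m" using assms(2) by (elim dvdE)
  show ?thesis unfolding e using assms(1) by (induction m) (simp_all add: funpow_add)
qed

text \<open>Split off one orbit: its length \<open>d\<close> is at least \<open>ppsum d\<close>, and
  passing to the lcm with a period of the rest is subadditive. As \<open>X\<close> need only be
  invariant, \<open>p\<close> stays unchanged in the induction.\<close>

lemma ex_common_period_ppsum_le:
  assumes "permutation p" "finite X" "p ` X \<subseteq> X"
  shows "\<exists>k>0. ppsum k \<le> card X \<and> (\<forall>x\<in>X. (p ^^ k) x = x)"
  using assms(2,3)
proof (induction X rule: finite_psubset_induct)
  case (psubset X)
  show ?case
  proof (cases "X = {}")
    case False
    then obtain a where a: "a \<in> X" by blast
    let ?d = "least_power p a" and ?O = "range (\<lambda>i. (p ^^ i) a)"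
    have d: "(p ^^ ?d) a = a" "?d > 0"
      using least_power_of_permutation[OF assms(1)] by auto
    have O: "?O = set (support p a)"
      by (rule support_set[OF assms(1), symmetric])
    have cardO: "card ?O = ?d"
      unfolding O using cycle_of_permutation[OF assms(1), of a] by (subst distinct_card) auto
    have "(p ^^ i) a \<in> X" for i
      using psubset.prems a by (induction i) auto
    then have OX: "?O \<subseteq> X" by auto
    have inj: "inj p" using assms(1) by (simp add: permutation bij_is_inj)
    have "p ` (X - ?O) \<subseteq> X - ?O"
    proof safe
      fix x i assume x: "x \<in> X" "x \<notin> ?O" "p x = (p ^^ i) a"
      \<comment> \<open>Adding a full period makes the exponent positive, so one \<open>p\<close>
        can be cancelled even if \<open>i = 0\<close>.\<close>
      have "(p ^^ i) a = (p ^^ (i + ?d)) a"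
        using d(1) by (simp add: funpow_add)
      also have "i + ?d = Suc (i + ?d - 1)" using d(2) by simp
      finally have "p x = p ((p ^^ (i + ?d - 1)) a)" using x(3) by simp
      then show False using x(2) inj by (auto dest: injD)
    qed (use psubset.prems in auto)
    moreover have "a \<in> ?O" by (rule range_eqI[of _ _ 0]) simp
    then have "X - ?O \<subset> X" using a by blast
    ultimately obtain k where k: "k > 0" "ppsum k \<le> card (X - ?O)" "\<forall>x\<in>X - ?O. (p ^^ k) x = x"
      using psubset.IH[of "X - ?O"] by blast
    have "ppsum (lcm ?d k) \<le> ppsum ?d + ppsum k"
      using d k by (intro ppsum_lcm_le)
    also have "\<dots> \<le> ?d + card (X - ?O)"
      using ppsum_le[OF d(2)] k(2) by simp
    also have "\<dots> = card X"
      using card_Diff_subset[OF finite_subset[OF OX] OX] card_mono[OF _ OX] psubset.hyps cardO by simp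
    finally have "ppsum (lcm ?d k) \<le> card X" .
    moreover have "(p ^^ lcm ?d k) x = x" if "x \<in> X" for x
    proof (cases "x \<in> ?O")
      case True
      then obtain i where x: "x = (p ^^ i) a" by auto
      have "(p ^^ ?d) x = (p ^^ i) ((p ^^ ?d) a)"
        unfolding x by (metis add.commute comp_apply funpow_add)
      then have "(p ^^ ?d) x = x" using d x by simp
      then show ?thesis by (rule funpow_dvd_fixpoint) simp
    next
      case False
      then have "(p ^^ k) x = x" using k that by auto
      then show ?thesis by (rule funpow_dvd_fixpoint) simp
    qed
    ultimately show ?thesis using d k by (intro exI[of _ "lcm ?d k"]) (auto simp: lcm_pos_nat)
  next
    case True
    then show ?thesis by (intro exI[of _ 1]) simp
  qed
qed

text \<open>Powers of a cycle rotate its list of entries; as these are distinct, the first entry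
  already determines the rotation.\<close>

lemma funpow_cycle_eq_id_iff:
  assumes "cycle cs" "cs \<noteq> []"
  shows "cycle_of_list cs ^^ i = id \<longleftrightarrow> length cs dvd i"
proof
  assume id: "cycle_of_list cs ^^ i = id"
  have "cs = rotate i cs" using cyclic_rotation[OF assms(1), of i] id by simp
  then have "cs ! 0 = cs ! (i mod length cs)"
    using assms(2) nth_rotate[of 0 cs i] by simp
  then show "length cs dvd i"
    using assms nth_eq_iff_index_eq[of cs 0 "i mod length cs"] by (simp add: dvd_eq_mod_eq_0)
next
  assume "length cs dvd i"
  then have "map (cycle_of_list cs ^^ i) cs = map id cs"
    using cyclic_rotation[OF assms(1), of i] by (simp add: rotate_id)
  then have "(cycle_of_list cs ^^ i) x = x" if "x \<in> set cs" for x
    using that unfolding map_eq_conv by simp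
  moreover have "(cycle_of_list cs ^^ i) x = x" if "x \<notin> set cs" for x
    using that permutes_not_in[OF permutes_funpow[OF cycle_permutes[of cs], of i]] by simp
  ultimately have "(cycle_of_list cs ^^ i) x = x" for x by blast
  then show "cycle_of_list cs ^^ i = id" by (simp add: fun_eq_iff)
qed

text \<open>One cycle for each prime power exactly dividing \<open>k\<close>. The induction splits
  off the power of one prime and puts its cycle on a subset \<open>B\<close>, disjoint from the
  support of the rest.\<close>

lemma ex_permutes_of_order:
  assumes "k > 0" "finite A" "card A = ppsum k"
  shows "\<exists>p. p permutes A \<and> (\<forall>i. p ^^ i = id \<longleftrightarrow> k dvd i)"
  using assms
proof (induction k arbitrary: A rule: less_induct)
  case (less k)
  show ?case
  proof (cases "k = 1")
    case True
    then have "A = {}" using less.prems by simp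
    moreover have "id ^^ i = (id :: 'a \<Rightarrow> 'a)" for i by (induction i) simp_all
    ultimately show ?thesis using True permutes_id[of A] by (intro exI[of _ id]) (simp del: id_apply)
  next
    case False
    then obtain q where q: "Factorial_Ring.prime q" "q dvd k"
      using prime_factor_nat by blast
    obtain m where m: "k = q ^ multiplicity q k * m" "\<not> q dvd m"
      using multiplicity_decompose'[of k q] less.prems(1) q(1) not_prime_unit by blast
    define c where "c = q ^ multiplicity q k"
    have mult: "multiplicity q k > 0"
      using q less.prems(1) by (simp add: prime_multiplicity_gt_zero_iff)
    have "c > 1" unfolding c_def using mult prime_gt_1_nat[OF q(1)] by (intro one_less_power)
    have "m > 0" using m less.prems(1) by (cases m) auto
    have k: "k = c * m" using m by (simp add: c_def)
    have cop: "coprime c m"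
      unfolding c_def using q m by (simp add: prime_imp_coprime)
    have "ppsum k = c + ppsum m"
      unfolding k using cop \<open>c > 1\<close> \<open>m > 0\<close> ppsum_prime_power[OF q(1) mult]
      by (simp only: ppsum_mult_coprime) (simp add: c_def)
    then obtain B where B: "B \<subseteq> A" "card B = c" "finite B"
      using less.prems obtain_subset_with_card_n[of c A] by auto
    obtain cs where cs: "set cs = B" "distinct cs" using B(3) finite_distinct_list by blast
    have len: "length cs = c" using cs B by (metis distinct_card)
    then have "cs \<noteq> []" using \<open>c > 1\<close> by auto
    define f where "f = cycle_of_list cs"
    have f: "f permutes B" using cycle_permutes[of cs] cs by (simp add: f_def)
    have f_id: "f ^^ i = id \<longleftrightarrow> c dvd i" for i
      unfolding f_def using funpow_cycle_eq_id_iff[of cs] cs len \<open>cs \<noteq> []\<close> by simp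
    have "m < k" using k \<open>c > 1\<close> \<open>m > 0\<close> by simp
    moreover have "card (A - B) = ppsum m"
      using B \<open>ppsum k = c + ppsum m\<close> less.prems by (simp add: card_Diff_subset)
    ultimately obtain g where g: "g permutes (A - B)" "\<And>i. g ^^ i = id \<longleftrightarrow> m dvd i"
      using less.IH[of m "A - B"] \<open>m > 0\<close> less.prems by blast
    have g': "g permutes (- B)" using g(1) by (rule permutes_subset) auto
    let ?p = "f \<circ> g"
    have "?p permutes A"
      using f g(1) B(1) by (intro permutes_compose) (auto elim: permutes_subset)
    \<comment> \<open>The powers of the composition act as those of \<open>f\<close> on
      \<open>B\<close> and of \<open>g\<close> off \<open>B\<close>, so it has order
      \<open>c * m\<close> by coprimality.\<close>
    have in_B: "(?p ^^ i) x = (f ^^ i) x" if "x \<in> B" for i x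
    proof (induction i)
      case (Suc i)
      have "(f ^^ i) x \<in> B" using permutes_funpow[OF f] that by (simp add: permutes_in_image)
      then show ?case using Suc permutes_not_in[OF g'] by simp
    qed simp
    have notin_B: "(?p ^^ i) x = (g ^^ i) x" if "x \<notin> B" for i x
    proof (induction i)
      case (Suc i)
      have "(g ^^ Suc i) x \<notin> B"
        using permutes_funpow[OF g', of "Suc i"] that permutes_in_image by (metis ComplD ComplI)
      then show ?case using Suc permutes_not_in[OF f] by simp
    qed simp
    have "?p ^^ i = id \<longleftrightarrow> k dvd i" for i
    proof
      assume p: "?p ^^ i = id"
      have "f ^^ i = id"
      proof
        fix x show "(f ^^ i) x = id x"
          using in_B[of x i] p permutes_not_in[OF permutes_funpow[OF f]] by (cases "x \<in> B") auto
      qed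
      moreover have "g ^^ i = id"
      proof
        fix x show "(g ^^ i) x = id x"
          using notin_B[of x i] p permutes_not_in[OF permutes_funpow[OF g']] by (cases "x \<in> B") auto
      qed
      ultimately show "k dvd i" unfolding k using f_id g(2) cop by (auto intro: divides_mult)
    next
      assume "k dvd i"
      then have "f ^^ i = id" "g ^^ i = id"
        using f_id g(2) k by (auto dest: dvd_mult_left dvd_mult_right)
      show "?p ^^ i = id"
      proof
        fix x show "(?p ^^ i) x = id x"
          using in_B[of x i] notin_B[of x i] \<open>f ^^ i = id\<close> \<open>g ^^ i = id\<close>
          by (cases "x \<in> B") simp_all
      qed
    qed
    then show ?thesis using \<open>?p permutes A\<close> by blast
  qed
qed

section \<open>The orders occurring in the symmetric group\<close>

lemma sym_group_nat_pow:
  fixes p :: "nat \<Rightarrow> nat" and k :: nat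
  shows "p [^]\<^bsub>sym_group n\<^esub> k = p ^^ k"
proof (induction k)
  case (Suc k)
  then show ?case
    using monoid.nat_pow_Suc[OF group.is_monoid[OF sym_group_is_group], where x = p]
    by (simp add: sym_group_mult funpow_Suc_right del: funpow.simps)
qed (simp add: sym_group_one monoid.nat_pow_0[OF group.is_monoid[OF sym_group_is_group]])

lemma finite_sym_group: "finite (carrier (sym_group n))"
  by (simp add: sym_group_def finite_permutations)

lemma ord_sym_group_pos: "p \<in> carrier (sym_group n) \<Longrightarrow> group.ord (sym_group n) p > 0"
  using group.ord_ge_1[OF sym_group_is_group finite_sym_group, of p n] by simp

lemma ppsum_ord_le:
  assumes "p \<in> carrier (sym_group n)"
  shows "ppsum (group.ord (sym_group n) p) \<le> n"
proof -
  have p: "p permutes {1..n}" using assms by (simp add: sym_group_carrier)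
  obtain k where k: "k > 0" "ppsum k \<le> n" "\<forall>x\<in>{1..n}. (p ^^ k) x = x"
    using ex_common_period_ppsum_le[OF sym_group_carrier'[OF assms], of "{1..n}"] permutes_image[OF p]
    unfolding card_atLeastAtMost diff_Suc_1 using finite_atLeastAtMost by blast
  have "p ^^ k = id"
  proof
    fix x show "(p ^^ k) x = id x"
      using k(3) permutes_not_in[OF permutes_funpow[OF p], of x k] by (cases "x \<in> {1..n}") simp_all
  qed
  then have "group.ord (sym_group n) p dvd k"
    using group.pow_eq_id[OF sym_group_is_group assms, of k]
    by (simp add: sym_group_nat_pow sym_group_one)
  then have "ppsum (group.ord (sym_group n) p) \<le> ppsum k" using k(1) by (rule ppsum_dvd_mono)
  then show ?thesis using k(2) by simp
qed

lemma ex_ord_sym_group: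
  assumes "k > 0" "ppsum k \<le> n"
  shows "\<exists>p\<in>carrier (sym_group n). group.ord (sym_group n) p = k"
proof -
  obtain A where A: "A \<subseteq> {1..n}" "card A = ppsum k" "finite A"
    using assms obtain_subset_with_card_n[of "ppsum k" "{1..n}"] by auto
  then obtain p where p: "p permutes A" "\<And>i. p ^^ i = id \<longleftrightarrow> k dvd i"
    using ex_permutes_of_order assms by blast
  have "p \<in> carrier (sym_group n)"
    using p(1) A(1) by (auto simp: sym_group_carrier elim: permutes_subset)
  then show ?thesis
    using p(2) by (auto simp: group.ord_unique[OF sym_group_is_group] sym_group_nat_pow sym_group_one)
qed

section \<open>Adjacency of orders\<close>

lemma (in group) ord_mult_dvd_ord_mult:
  assumes "x \<in> carrier G" "y \<in> carrier G" "x \<otimes> y = y \<otimes> x" "coprime (ord x) (ord y)"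
  shows "ord x * ord y dvd ord (x \<otimes> y)"
proof -
  let ?i = "ord (x \<otimes> y)"
  \<comment> \<open>With \<open>j = ord y\<close> the factor in \<open>y\<close> vanishes, so
    \<open>ord x\<close> divides \<open>?i * ord y\<close> and by coprimality \<open>?i\<close>;
    likewise with \<open>j = ord x\<close>.\<close>
  have pow: "x [^] (?i * j) \<otimes> y [^] (?i * j) = \<one>" for j :: nat
  proof -
    have "(x \<otimes> y) [^] (?i * j) = \<one>"
      using assms by (simp add: pow_eq_id)
    then show ?thesis using pow_mult_distrib[OF assms(3,1,2)] by simp
  qed
  have "y [^] (?i * ord y) = \<one>" "x [^] (?i * ord x) = \<one>"
    using assms by (simp_all add: pow_eq_id)
  then have "x [^] (?i * ord y) = \<one>" "y [^] (?i * ord x) = \<one>"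
    using pow[of "ord y"] pow[of "ord x"] assms by simp_all
  then have "ord x dvd ?i * ord y" "ord y dvd ?i * ord x"
    using assms by (simp_all add: pow_eq_id)
  then have "ord x dvd ?i" "ord y dvd ?i"
    using assms(4) by (simp_all only: coprime_dvd_mult_left_iff coprime_commute[of "ord y" "ord x"])
  then show ?thesis using assms(4) by (rule divides_mult)
qed

text \<open>Adjacency of distinct vertices seen on their orders, which turns the graph problem into
  arithmetic.\<close>

definition ord_adjacent :: "('a, 'm) monoid_scheme \<Rightarrow> nat \<Rightarrow> nat \<Rightarrow> bool" where
  "ord_adjacent G a b \<longleftrightarrow> a = b \<or> (\<exists>g\<in>carrier G. \<exists>h\<in>carrier G.
     group.ord G g = a \<and> group.ord G h = b \<and> g \<noteq> h \<and> g \<otimes>\<^bsub>G\<^esub> h = h \<otimes>\<^bsub>G\<^esub> g)"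

text \<open>Suitable powers of the single element \<open>g\<close> have orders \<open>a\<close> and
  \<open>b\<close>, and they commute.\<close>

lemma (in group) ord_adjacentI:
  assumes "g \<in> carrier G" "ord g > 0" "a dvd ord g" "b dvd ord g"
  shows "ord_adjacent G a b"
proof (cases "a = b")
  case False
  let ?x = "\<lambda>a. g [^] (ord g div a)"
  have ord: "ord (?x c) = c" if "c dvd ord g" for c
    using that assms(1,2) by (subst ord_pow) (auto elim!: dvdE)
  have "?x a \<noteq> ?x b" using ord[OF assms(3)] ord[OF assms(4)] False by metis
  moreover have "?x a \<otimes> ?x b = ?x b \<otimes> ?x a"
    using assms(1) by (simp add: nat_pow_mult add.commute)
  ultimately show ?thesis
    unfolding ord_adjacent_def using assms ord nat_pow_closed[OF assms(1)] by blast
qed (simp add: ord_adjacent_def)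

lemma ord_adjacent_sym_groupI:
  assumes "k > 0" "ppsum k \<le> n" "a dvd k" "b dvd k"
  shows "ord_adjacent (sym_group n) a b"
proof -
  obtain g where "g \<in> carrier (sym_group n)" "group.ord (sym_group n) g = k"
    using ex_ord_sym_group[OF assms(1,2)] by blast
  then show ?thesis
    using group.ord_adjacentI[OF sym_group_is_group, of g n a b] assms by simp
qed

text \<open>The source of all non-adjacencies: the order of the commuting product is a multiple of
  \<open>a * b\<close>. If \<open>a = b\<close>, coprimality forces both to be 1.\<close>

lemma ord_adjacent_sym_groupD:
  assumes "ord_adjacent (sym_group n) a b" "coprime a b"
  shows "ppsum a + ppsum b \<le> n"
proof (cases "a = b")
  case True
  then show ?thesis using assms(2) by simp
next
  case False
  let ?G = "sym_group n"
  interpret group ?G by (rule sym_group_is_group)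
  obtain g h where gh: "g \<in> carrier ?G" "h \<in> carrier ?G" "ord g = a" "ord h = b"
    "g \<otimes>\<^bsub>?G\<^esub> h = h \<otimes>\<^bsub>?G\<^esub> g"
    using assms(1) False unfolding ord_adjacent_def by blast
  have "a > 0" "b > 0" using gh ord_sym_group_pos by auto
  then have "ppsum a + ppsum b = ppsum (a * b)" using assms(2) by (simp add: ppsum_mult_coprime)
  also have "\<dots> \<le> ppsum (ord (g \<otimes>\<^bsub>?G\<^esub> h))"
    using ord_mult_dvd_ord_mult[of g h] gh assms(2) ord_sym_group_pos
    by (intro ppsum_dvd_mono) auto
  also have "\<dots> \<le> n" using gh by (intro ppsum_ord_le) simp
  finally show ?thesis .
qed

section \<open>Components of symmetric digraphs\<close>

text \<open>\<open>connected\<close> refers to the symmetric closure, which adds no reachability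
  here; thus directed paths suffice below.\<close>

lemma (in sym_digraph) strongly_connected_iff_connected:
  "strongly_connected G \<longleftrightarrow> Digraph_Component.connected G"
  using symmetric_connected_imp_strongly_connected[OF sym_arcs] reachable_mk_symmetricI
  by (auto simp: Digraph_Component.connected_def strongly_connected_def)

lemma arc_mono_connected: "arc_mono Digraph_Component.connected"
  unfolding arc_mono_def
  by (metis spanning_def subgraphE wf_digraph.connected_spanning_imp_connected)

text \<open>The two notions may differ on a subgraph that is not symmetric, but agree on induced
  ones, and maximal subgraphs for either notion are induced.\<close>

lemma (in sym_digraph) connected_components_eq_sccs:
  "connected_components G = sccs"
proof -
  have eq: "strongly_connected H \<longleftrightarrow> Digraph_Component.connected H" if "induced_subgraph H G" for H
    using sym_digraph.strongly_connected_iff_connected[OF induced_graph_imp_graph[OF that]] .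
  have "max_subgraph strongly_connected H" if H: "max_subgraph Digraph_Component.connected H" for H
  proof (rule max_subgraphI)
    have ind: "induced_subgraph H G"
      using H arc_mono_connected by (rule induced_subgraphI_arc_mono)
    show "strongly_connected H" using eq[OF ind] H by (simp add: max_subgraph_prop)
    show "subgraph H G" using H by (rule subgraphI_max_subgraph)
    fix K assume K: "H \<noteq> K" "subgraph H K" "subgraph K G"
    have "Digraph_Component.connected K" if "strongly_connected K"
    proof -
      interpret K: wf_digraph K using K(3) by auto
      show ?thesis using that K.reachable_mk_symmetricI
        by (auto simp: Digraph_Component.connected_def strongly_connected_def)
    qed
    then show "\<not> strongly_connected K" using H K unfolding max_subgraph_def by metis
  qed
  moreover have "max_subgraph Digraph_Component.connected H" if H: "max_subgraph strongly_connected H" for H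
  proof (rule max_subgraphI)
    have ind: "induced_subgraph H G"
      using H arc_mono_strongly_connected by (rule induced_subgraphI_arc_mono)
    show "Digraph_Component.connected H" using eq[OF ind] H by (simp add: max_subgraph_prop)
    show sub: "subgraph H G" using H by (rule subgraphI_max_subgraph)
    fix K assume K: "H \<noteq> K" "subgraph H K" "subgraph K G"
    show "\<not> Digraph_Component.connected K"
    proof
      assume con: "Digraph_Component.connected K"
      \<comment> \<open>\<open>K\<close> itself need not be induced; filling in all arcs between its
        vertices keeps it connected and makes it symmetric.\<close>
      let ?K = "G \<restriction> verts K"
      have indK: "induced_subgraph ?K G"
        using K(3) by (intro induced_induce) auto
      have KK: "subgraph K ?K" using K(3) by (rule subgraph_induce_subgraphI2)
      have "Digraph_Component.connected ?K"
        using arc_mono_connected con KK unfolding arc_mono_def by fastforce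
      then have "strongly_connected ?K" using eq[OF indK] by simp
      moreover have "subgraph H ?K" using K(2) KK by (rule subgraph_trans)
      ultimately have "?K = H" using H indK unfolding max_subgraph_def
        by (metis induced_imp_subgraph)
      then have "verts K \<subseteq> verts H" "arcs K \<subseteq> arcs H" using KK by auto
      then have "K = H" using K(2) by (auto simp: subgraph_def compatible_def)
      then show False using K(1) by simp
    qed
  qed
  ultimately show ?thesis
    unfolding connected_components_def sccs_altdef2 by blast
qed

lemma (in sym_digraph) card_connected_components_eq_2:
  assumes "s \<in> verts G" "t \<in> verts G" "\<not> s \<rightarrow>\<^sup>* t"
    and "\<And>v. v \<in> verts G \<Longrightarrow> v \<rightarrow>\<^sup>* s \<or> v \<rightarrow>\<^sup>* t"
  shows "card (connected_components G) = 2"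
proof -
  have "scc_of v \<in> {scc_of s, scc_of t}" if "v \<in> verts G" for v
    using assms(4)[OF that] scc_ofI_reachable scc_of_eq by blast
  then have "scc_of ` verts G = {scc_of s, scc_of t}"
    using assms(1,2) by auto
  moreover have "t \<in> scc_of t" "t \<notin> scc_of s"
    using assms by (auto simp: scc_of_def intro: in_scc_of_self)
  then have "scc_of s \<noteq> scc_of t" by blast
  ultimately have "card sccs_verts = 2"
    by (simp add: sccs_verts_conv_scc_of)
  then show ?thesis by (simp add: connected_components_eq_sccs card_sccs_verts)
qed

section \<open>The order super commuting graph\<close>

lemma dominates_order_super_commuting_graph_iff:
  "g \<rightarrow>\<^bsub>order_super_commuting_graph G\<^esub> h \<longleftrightarrow>
     g \<in> carrier G \<and> h \<in> carrier G \<and> g \<noteq> h \<and> ord_adjacent G (group.ord G g) (group.ord G h)"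
  by (auto simp: order_super_commuting_graph_def ord_adjacent_def arcs_ends_conv)

lemma verts_order_super_commuting_graph [simp]:
  "verts (order_super_commuting_graph G) = carrier G"
  by (simp add: order_super_commuting_graph_def)

lemma verts_reduced_order_super_commuting_graph:
  "verts (reduced_order_super_commuting_graph G) =
     carrier G - dominant_vertices (order_super_commuting_graph G)"
  by (simp add: reduced_order_super_commuting_graph_def Let_def)

lemma dominates_reduced_order_super_commuting_graph_iff:
  "g \<rightarrow>\<^bsub>reduced_order_super_commuting_graph G\<^esub> h \<longleftrightarrow>
     g \<in> verts (reduced_order_super_commuting_graph G) \<and>
     h \<in> verts (reduced_order_super_commuting_graph G) \<and>
     g \<rightarrow>\<^bsub>order_super_commuting_graph G\<^esub> h"
  by (auto simp: reduced_order_super_commuting_graph_def Let_def arcs_ends_conv)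

lemma sym_digraph_reduced_order_super_commuting_graph:
  assumes "finite (carrier G)"
  shows "sym_digraph (reduced_order_super_commuting_graph G)"
proof -
  interpret D: graph "order_super_commuting_graph G"
    using assms by (rule graph_order_super_commuting_graph)
  show ?thesis
    unfolding reduced_order_super_commuting_graph_def Let_def
    by (intro D.induced_graph_imp_graph D.induced_induce) auto
qed

section \<open>The reduced graph of the symmetric group\<close>

context
  fixes n :: nat
  assumes n_ge_4: "n \<ge> 4"
begin

private abbreviation (input) "S \<equiv> sym_group n"
private abbreviation (input) "R \<equiv> reduced_order_super_commuting_graph S"
private abbreviation (input) "o_S \<equiv> group.ord S"

interpretation S: group S by (rule sym_group_is_group)

interpretation R: sym_digraph R
  by (intro sym_digraph_reduced_order_super_commuting_graph finite_sym_group)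

lemma nondominantI:
  assumes "g \<in> carrier S" "m > 0" "ppsum m \<le> n" "coprime m (o_S g)" "ppsum m + ppsum (o_S g) > n"
  shows "g \<in> verts R"
proof -
  obtain h where h: "h \<in> carrier S" "o_S h = m"
    using ex_ord_sym_group assms by blast
  have "\<not> ord_adjacent S (o_S g) m"
    using ord_adjacent_sym_groupD[of n "o_S g" m] assms by (auto simp: coprime_commute)
  \<comment> \<open>Otherwise the common order is coprime to itself, hence 1, and both values of
    \<open>ppsum\<close> vanish.\<close>
  moreover have "g \<noteq> h"
    using h assms(2,4,5) by (auto simp: n_ge_4)
  ultimately have "g \<notin> dominant_vertices (order_super_commuting_graph S)"
    using h by (auto simp: dominant_vertices_def dominates_order_super_commuting_graph_iff)
  then show ?thesis using assms(1) by (simp add: verts_reduced_order_super_commuting_graph)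
qed

lemma ord_gt_1:
  assumes "g \<in> verts R"
  shows "o_S g > 1"
proof -
  have g: "g \<in> carrier S" using assms by (simp add: verts_reduced_order_super_commuting_graph)
  have "o_S g \<noteq> 1"
  proof
    assume 1: "o_S g = 1"
    have "ord_adjacent S 1 (o_S h)" if "h \<in> carrier S" for h
      using S.ord_adjacentI[OF that ord_sym_group_pos[OF that], of 1 "o_S h"] by simp
    then have "g \<in> dominant_vertices (order_super_commuting_graph S)"
      using g 1 by (auto simp: dominant_vertices_def dominates_order_super_commuting_graph_iff)
    then show False using assms by (simp add: verts_reduced_order_super_commuting_graph)
  qed
  then show ?thesis using ord_sym_group_pos[OF g] by linarith
qed

lemma reachableI:
  assumes "g \<in> verts R" "h \<in> verts R" "ord_adjacent S (o_S g) (o_S h)"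
  shows "g \<rightarrow>\<^sup>*\<^bsub>R\<^esub> h"
proof (cases "g = h")
  case False
  then have "g \<rightarrow>\<^bsub>R\<^esub> h"
    using assms by (auto simp: dominates_reduced_order_super_commuting_graph_iff
      dominates_order_super_commuting_graph_iff verts_reduced_order_super_commuting_graph)
  then show ?thesis by (rule R.reachable_adjI)
qed (use assms in simp)

lemma eq_if_large_prime_dvd_ord:
  assumes "g \<in> carrier S" "Factorial_Ring.prime p" "p \<ge> n - 1" "p dvd o_S g"
  shows "o_S g = p"
proof -
  obtain r where r: "o_S g = p * r" using assms(4) by (elim dvdE)
  have "r \<noteq> 0" using r ord_sym_group_pos[OF assms(1)] by (cases r) auto
  moreover have "\<not> r > 1"
    using ppsum_prime_mult_ge[OF assms(2), of r] ppsum_ord_le[OF assms(1)] assms(3) n_ge_4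
    unfolding r by linarith
  ultimately show ?thesis using r by (metis One_nat_def Suc_lessI mult.right_neutral not_gr_zero)
qed

text \<open>Non-dominance of the small prime orders is an assumption because the prime and the
  non-prime case prove it differently.\<close>

lemma reachable_involution:
  assumes small: "\<And>g q. g \<in> carrier S \<Longrightarrow> o_S g = q \<Longrightarrow> Factorial_Ring.prime q \<Longrightarrow> q + 2 \<le> n
      \<Longrightarrow> g \<in> verts R"
    and t: "t \<in> carrier S" "o_S t = 2"
    and v: "v \<in> verts R" "\<And>p. Factorial_Ring.prime p \<Longrightarrow> p \<ge> n - 1 \<Longrightarrow> o_S v \<noteq> p"
  shows "v \<rightarrow>\<^sup>*\<^bsub>R\<^esub> t"
proof -
  have vS: "v \<in> carrier S" using v by (simp add: verts_reduced_order_super_commuting_graph)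
  obtain q where q: "Factorial_Ring.prime q" "q dvd o_S v"
    using prime_factor_nat[of "o_S v"] ord_gt_1[OF v(1)] by auto
  have "\<not> q \<ge> n - 1"
    using eq_if_large_prime_dvd_ord[OF vS q(1) _ q(2)] v(2)[OF q(1)] by blast
  then have qn: "q + 2 \<le> n" by linarith
  then obtain w where w: "w \<in> carrier S" "o_S w = q"
    using ex_ord_sym_group[of q n] q(1) by (auto simp: ppsum_prime prime_gt_0_nat)
  have wR: "w \<in> verts R" using small[OF w q(1) qn] .
  have tR: "t \<in> verts R" using small[OF t] n_ge_4 by simp
  have "v \<rightarrow>\<^sup>*\<^bsub>R\<^esub> w"
    using S.ord_adjacentI[OF vS ord_sym_group_pos[OF vS], of "o_S v" q] q w
    by (intro reachableI v wR) simp
  also have "w \<rightarrow>\<^sup>*\<^bsub>R\<^esub> t"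
  proof (intro reachableI wR tR)
    show "ord_adjacent S (o_S w) (o_S t)"
    proof (cases "q = 2")
      case False
      then have "coprime q 2" using primes_coprime[OF q(1) two_is_prime_nat] by simp
      then have "ppsum (q * 2) = q + 2"
        using q(1) by (simp add: ppsum_mult_coprime ppsum_prime prime_gt_0_nat)
      then show ?thesis
        unfolding w t using qn q(1)
        by (intro ord_adjacent_sym_groupI[of "q * 2"]) (auto simp: prime_gt_0_nat)
    qed (simp add: ord_adjacent_def w t)
  qed
  finally show ?thesis .
qed

lemma connected_if_not_prime:
  assumes np: "\<not> Factorial_Ring.prime n" "\<not> Factorial_Ring.prime (n - 1)"
  shows "Digraph_Component.connected R"
proof -
  obtain P where P: "finite P" "\<And>p. p \<in> P \<Longrightarrow> Factorial_Ring.prime p \<and> odd p" "\<Sum>P = n \<or> \<Sum>P + 1 = n"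
    using ex_odd_primes_sum[of n] n_ge_4 by auto
  have nondom: "g \<in> verts R" if g: "g \<in> carrier S" "o_S g = q" and q: "Factorial_Ring.prime q" for g q
  proof (cases "q \<in> P")
    case False
    \<comment> \<open>The order \<open>\<Prod>P\<close> takes up at least \<open>n - 1\<close>
      points, leaving no room for \<open>q \<ge> 2\<close> more.\<close>
    have "coprime (\<Prod>P) q"
      using P(2) q False by (intro prod_coprime_left) (metis primes_coprime)
    moreover have "\<Prod>P > 0" using P(2) by (intro prod_pos) (auto simp: prime_gt_0_nat)
    moreover have "ppsum (\<Prod>P) = \<Sum>P" using P by (intro ppsum_prod_primes) auto
    ultimately show ?thesis
      using g q P(3) prime_ge_2_nat[OF q]
      by (intro nondominantI[of g "\<Prod>P"]) (auto simp: ppsum_prime)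
  next
    \<comment> \<open>Replace the summand \<open>q\<close> by the largest power of two below it: fewer than \<open>q\<close> points
      remain, so a permutation of the resulting order commutes with no element of order \<open>q\<close>.\<close>
    case True
    let ?Q = "P - {q}"
    obtain k where k: "2 ^ k \<le> q" "q < 2 ^ (k + 1)"
      using ex_power_ivl1[of 2 q] prime_ge_2_nat[OF q] by auto
    have "odd q" using P(2) True by auto
    have "k > 0" using k prime_ge_2_nat[OF q] by (cases k) auto
    have "coprime (\<Prod>?Q) q"
      using P(2) q by (intro prod_coprime_left) (metis DiffE insertI1 primes_coprime)
    moreover have "coprime (2 ^ k) q" using \<open>odd q\<close> by simp
    ultimately have cop: "coprime (2 ^ k * \<Prod>?Q) q" by simp
    have "coprime (2 ^ k) (\<Prod>?Q)"
      using P(2) by (intro prod_coprime_right) auto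
    moreover have pos: "\<Prod>?Q > 0" using P(2) by (intro prod_pos) (auto simp: prime_gt_0_nat)
    moreover have "ppsum (\<Prod>?Q) = \<Sum>?Q" using P by (intro ppsum_prod_primes) auto
    ultimately have "ppsum (2 ^ k * \<Prod>?Q) = 2 ^ k + \<Sum>?Q"
      using \<open>k > 0\<close> by (simp add: ppsum_mult_coprime ppsum_prime_power)
    moreover have "\<Sum>P = q + \<Sum>?Q" using P(1) True by (simp add: sum.remove)
    \<comment> \<open>A power of at least 2 outweighs the possible deficit of 1 of the sum of
      \<open>P\<close> against \<open>n\<close>.\<close>
    moreover have "(2::nat) ^ 1 \<le> 2 ^ k" using \<open>k > 0\<close> by (intro power_increasing) auto
    ultimately show ?thesis
      using g q P(3) k cop pos
      by (intro nondominantI[of g "2 ^ k * \<Prod>?Q"]) (auto simp: ppsum_prime)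
  qed
  obtain t where t: "t \<in> carrier S" "o_S t = 2"
    using ex_ord_sym_group[of 2 n] n_ge_4 by (auto simp: ppsum_prime)
  have "v \<rightarrow>\<^sup>*\<^bsub>R\<^esub> t" if v: "v \<in> verts R" for v
  proof (rule reachable_involution[OF _ t v])
    fix p assume p: "Factorial_Ring.prime p" "p \<ge> n - 1"
    have vS: "v \<in> carrier S" using v by (simp add: verts_reduced_order_super_commuting_graph)
    show "o_S v \<noteq> p"
    proof
      assume "o_S v = p"
      then have "p \<le> n" using ppsum_ord_le[OF vS] p(1) by (simp add: ppsum_prime)
      then have "p = n \<or> p = n - 1" using p(2) by linarith
      then show False using np p(1) by auto
    qed
  qed (rule nondom)
  moreover have "t \<in> verts R" using nondom[OF t] by simp
  ultimately have "strongly_connected R"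
    using R.reachable_trans R.symmetric_reachable' by (intro strongly_connectedI) blast+
  then show ?thesis by (simp add: R.strongly_connected_iff_connected)
qed

lemma two_components_if_prime:
  assumes p: "Factorial_Ring.prime p" "p = n \<or> p = n - 1"
  shows "\<not> Digraph_Component.connected R \<and> card (connected_components R) = 2"
proof -
  have p3: "p \<ge> 3" "p \<ge> n - 1" "p + 1 \<ge> n" "p \<le> n" using p n_ge_4 by auto
  then have "odd p" using p(1) by (intro prime_odd_nat) auto
  have cop: "coprime p (o_S g)" if "g \<in> carrier S" "o_S g \<noteq> p" for g
    using eq_if_large_prime_dvd_ord[OF that(1) p(1) p3(2)] that(2) by (intro prime_imp_coprime p) auto
  \<comment> \<open>Order \<open>p\<close> is not adjacent to 2, and any other order above 1 is not
    adjacent to \<open>p\<close>, since \<open>p + 2 > n\<close>.\<close>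
  have nondom: "g \<in> verts R" if g: "g \<in> carrier S" "o_S g > 1" for g
  proof (cases "o_S g = p")
    case True
    then show ?thesis
      using g p p3 \<open>odd p\<close> by (intro nondominantI[of g 2]) (auto simp: ppsum_prime)
  next
    case False
    then show ?thesis
      using g p p3 cop[OF g(1)] ppsum_ge_2[OF g(2)]
      by (intro nondominantI[of g p]) (auto simp: ppsum_prime)
  qed
  obtain t where t: "t \<in> carrier S" "o_S t = 2"
    using ex_ord_sym_group[of 2 n] n_ge_4 by (auto simp: ppsum_prime)
  obtain c where c: "c \<in> carrier S" "o_S c = p"
    using ex_ord_sym_group[of p n] p p3 by (auto simp: ppsum_prime)
  have tR: "t \<in> verts R" and cR: "c \<in> verts R"
    using nondom t c p3 by auto
  have reach: "v \<rightarrow>\<^sup>*\<^bsub>R\<^esub> t \<or> v \<rightarrow>\<^sup>*\<^bsub>R\<^esub> c" if v: "v \<in> verts R" for v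
  proof (cases "o_S v = p")
    case True
    then show ?thesis using v cR c by (intro disjI2 reachableI) (auto simp: ord_adjacent_def)
  next
    case False
    have vS: "v \<in> carrier S" using v by (simp add: verts_reduced_order_super_commuting_graph)
    have "v \<rightarrow>\<^sup>*\<^bsub>R\<^esub> t"
    proof (rule reachable_involution[OF _ t v])
      fix q assume q: "Factorial_Ring.prime q" "q \<ge> n - 1"
      show "o_S v \<noteq> q"
      proof
        assume ov: "o_S v = q"
        then have "q \<le> n" using ppsum_ord_le[OF vS] q(1) by (simp add: ppsum_prime)
        moreover have "odd q" using q n_ge_4 by (intro prime_odd_nat) auto
        \<comment> \<open>Both are odd and lie in \<open>{n - 1, n}\<close>.\<close>
        ultimately have "q = p" using q(2) p3 \<open>odd p\<close> by presburger
        then show False using ov False by simp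
      qed
    qed (use nondom prime_gt_1_nat in auto)
    then show ?thesis ..
  qed
  \<comment> \<open>Invariant along paths from \<open>t\<close>: a step to order \<open>p\<close>
    would come from a coprime order above 1 and need \<open>p + 2 \<le> n\<close>.\<close>
  have "o_S u \<noteq> p" if "t \<rightarrow>\<^sup>*\<^bsub>R\<^esub> u" for u
    using that
  proof (induction rule: R.reachable_induct)
    case base
    then show ?case using t p3 by simp
  next
    case (step u w)
    have adj: "ord_adjacent S (o_S u) (o_S w)" "u \<in> carrier S" "u \<in> verts R"
      using step by (auto simp: dominates_reduced_order_super_commuting_graph_iff
        dominates_order_super_commuting_graph_iff)
    show ?case
    proof
      assume "o_S w = p"
      then have "ppsum (o_S u) + ppsum p \<le> n"
        using adj cop[of u] step.IH
        by (intro ord_adjacent_sym_groupD) (auto simp: coprime_commute)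
      then show False
        using ppsum_ge_2[OF ord_gt_1[OF adj(3)]] p p3 by (auto simp: ppsum_prime)
    qed
  qed
  then have unreach: "\<not> t \<rightarrow>\<^sup>*\<^bsub>R\<^esub> c" using c by blast
  then have "\<not> strongly_connected R" using tR cR by (auto simp: strongly_connected_def)
  moreover have "card (connected_components R) = 2"
    using tR cR unreach reach by (rule R.card_connected_components_eq_2)
  ultimately show ?thesis by (simp add: R.strongly_connected_iff_connected)
qed

end

theorem proposition4p9:
  fixes n :: nat
  assumes "n \<ge> 4"
  shows "(Digraph_Component.connected (reduced_order_super_commuting_graph (sym_group n)) \<longleftrightarrow>
            \<not> Factorial_Ring.prime n \<and> \<not> Factorial_Ring.prime (n - 1)) \<and>
         (\<not> Digraph_Component.connected (reduced_order_super_commuting_graph (sym_group n)) \<longrightarrow>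
            card (connected_components (reduced_order_super_commuting_graph (sym_group n))) = 2)"
  using connected_if_not_prime[OF assms] two_components_if_prime[OF assms, of n]
    two_components_if_prime[OF assms, of "n - 1"] by blast

end
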